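(* Let $b,c\in\Sigma^{\mathbb Z}$. Then the following are equivalent: (i) $A_b\in\mathrm{Lim}(A_c)$; (ii) for every $w\in\mathcal W(b)$, it holds that $\#_\varepsilon(w,c)=\infty$ for all $\varepsilon>0$; that is, (a) $\#(w,c)=\infty$ or (b) $w\in\mathrm{clos}\big(\mathcal W_n(c)\setminus\{w\}\big)$ with $n=|w|$. If $\Sigma$ is discrete, then (b) is impossible, so that (ii) always means (a) (for every $w\in\mathcal W(b)$) in that case.
   Context: $\Sigma\subset\mathbb C$ is a fixed compact set, the alphabet. $\Sigma$ is called discrete if $\inf_{s,t\in\Sigma,\,s\ne t}|s-t|>0$. On $\ell^2=\ell^2(\mathbb Z)$, let $(Sx)_n=x_{n-1}$ be the shift and $(M_bx)_n=b(n)x_n$ multiplication by $b\in\ell^\infty(\mathbb Z)$. Fix a band structure in which exactly one distinguished diagonal varies and all others are constant: fix $w_0\in\mathbb N$, $j\in\{-w_0,\dots,w_0\}$ and constants $a_i\in\mathbb C$ for $i\in\{-w_0,\dots,w_0\}\setminus\{j\}$, and for $b\in\Sigma^{\mathbb Z}$ put $A_b=M_bS^j+\sum_{i\ne j}a_iS^i$ (e.g. the discrete Schrödinger operator $S^{-1}+M_b+S$). Limit operators: for a band operator $A$ on $\ell^2$, $\mathrm{Lim}(A)$ is the set of all operators $A_h$ that are strong limits (pointwise on $\ell^2$) of $S^{-h_n}AS^{h_n}$ for some sequence $h=(h_n)$ in $\mathbb Z$ with $|h_n|\to\infty$. Words: $\Sigma^*=\bigcup_{n=0}^\infty\Sigma^n$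 is the set of finite words over $\Sigma$; $[a_1\dots a_n]$ is the word $w\in\Sigma^n$ with $w(k)=a_k$; $|w|$ is the length of $w$. For $w\in\Sigma^*$, $b\in\Sigma^{\mathbb Z}$ and $\varepsilon>0$: $pos(w,b)=\{k\in\mathbb Z:[b(k)\dots b(k+|w|-1)]=w\}$, $pos_\varepsilon(w,b)=\{k\in\mathbb Z:\|[b(k)\dots b(k+|w|-1)]-w\|_\infty<\varepsilon\}$, $\#(w,b)$ and $\#_\varepsilon(w,b)$ are the numbers of elements of $pos(w,b)$ and $pos_\varepsilon(w,b)$, respectively. $\mathcal W(b)=\{w\in\Sigma^*:\#(w,b)\ge1\}$ is the set of all finite subwords of $b$, and $\mathcal W_n(b)=\{w\in\mathcal W(b):|w|=n\}$. $\mathrm{clos}$ of a subset of $\Sigma^n$ is its closure in $\mathbb C^n$. *)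

theory Defs
  imports "HOL-Analysis.Analysis"
begin

section \<open>The space of square-summable bilateral complex sequences\<close>

abbreviation square_summable :: "(int \<Rightarrow> complex) \<Rightarrow> bool" where
  "square_summable x \<equiv> (\<lambda>n. (cmod (x n))\<^sup>2) summable_on UNIV"

lemma square_summable_L2_set_le:
  assumes "square_summable x" "finite F"
  shows "L2_set (\<lambda>n. cmod (x n)) F \<le> sqrt (\<Sum>\<^sub>\<infinity>n. (cmod (x n))\<^sup>2)"
  unfolding L2_set_def
  by (rule real_sqrt_le_mono, rule finite_sum_le_infsum) (use assms in auto)

lemma square_summableI:
  assumes "\<And>F. finite F \<Longrightarrow> L2_set (\<lambda>n. cmod (x n)) F \<le> C"
  shows "square_summable x" and "sqrt (\<Sum>\<^sub>\<infinity>n. (cmod (x n))\<^sup>2) \<le> C"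
proof -
  have C: "0 \<le> C" using assms[of "{}"] by simp
  have bd: "(\<Sum>n\<in>F. (cmod (x n))\<^sup>2) \<le> C\<^sup>2" if "finite F" for F
  proof -
    have "sqrt (\<Sum>n\<in>F. (cmod (x n))\<^sup>2) \<le> C"
      using assms[OF that] by (simp add: L2_set_def)
    then show ?thesis by (rule sqrt_le_D)
  qed
  show s: "square_summable x"
    by (rule nonneg_bdd_above_summable_on) (auto intro!: bdd_aboveI2[where M="C\<^sup>2"] bd)
  have "(\<Sum>\<^sub>\<infinity>n. (cmod (x n))\<^sup>2) \<le> C\<^sup>2"
    by (rule infsum_le_finite_sums[OF s]) (use bd in auto)
  then show "sqrt (\<Sum>\<^sub>\<infinity>n. (cmod (x n))\<^sup>2) \<le> C"
    using C by (simp add: real_le_lsqrt)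
qed

typedef ell2 = "{x. square_summable x}"
  morphisms coord Abs_ell2
  by (rule exI[of _ "\<lambda>_. 0"]) simp

setup_lifting type_definition_ell2

lemma L2_set_add_le:
  fixes x y :: "int \<Rightarrow> complex"
  assumes "square_summable x" "square_summable y" "finite F"
  shows "L2_set (\<lambda>n. cmod (x n + y n)) F
           \<le> sqrt (\<Sum>\<^sub>\<infinity>n. (cmod (x n))\<^sup>2) + sqrt (\<Sum>\<^sub>\<infinity>n. (cmod (y n))\<^sup>2)"
proof -
  have "L2_set (\<lambda>n. cmod (x n + y n)) F \<le> L2_set (\<lambda>n. cmod (x n) + cmod (y n)) F"
    by (rule L2_set_mono) (auto intro: norm_triangle_ineq)
  also have "\<dots> \<le> L2_set (\<lambda>n. cmod (x n)) F + L2_set (\<lambda>n. cmod (y n)) F"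
    by (rule L2_set_triangle_ineq)
  also have "\<dots> \<le> sqrt (\<Sum>\<^sub>\<infinity>n. (cmod (x n))\<^sup>2) + sqrt (\<Sum>\<^sub>\<infinity>n. (cmod (y n))\<^sup>2)"
    using square_summable_L2_set_le[OF assms(1,3)] square_summable_L2_set_le[OF assms(2,3)]
    by (rule add_mono)
  finally show ?thesis .
qed

lemma L2_set_bounded_mult_le:
  fixes x y :: "int \<Rightarrow> complex"
  assumes "square_summable x" "finite F" "\<And>n. cmod (y n) \<le> K * cmod (x n)" "0 \<le> K"
  shows "L2_set (\<lambda>n. cmod (y n)) F \<le> K * sqrt (\<Sum>\<^sub>\<infinity>n. (cmod (x n))\<^sup>2)"
proof -
  have "L2_set (\<lambda>n. cmod (y n)) F \<le> L2_set (\<lambda>n. K * cmod (x n)) F"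
    by (rule L2_set_mono) (use assms in auto)
  also have "\<dots> = K * L2_set (\<lambda>n. cmod (x n)) F"
    using assms(4) by (simp add: L2_set_right_distrib)
  also have "\<dots> \<le> K * sqrt (\<Sum>\<^sub>\<infinity>n. (cmod (x n))\<^sup>2)"
    by (rule mult_left_mono) (use square_summable_L2_set_le assms in auto)
  finally show ?thesis .
qed

lemma square_summable_dominated:
  assumes "square_summable x" "\<And>n. cmod (y n) \<le> K * cmod (x n)" "0 \<le> K"
  shows "square_summable y"
  by (rule square_summableI(1)[OF L2_set_bounded_mult_le[OF assms(1) _ assms(2,3)]])

lemma square_summable_add:
  "square_summable x \<Longrightarrow> square_summable y \<Longrightarrow> square_summable (\<lambda>n. x n + y n)"
  by (rule square_summableI(1)[OF L2_set_add_le])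

lemma square_summable_uminus: "square_summable x \<Longrightarrow> square_summable (\<lambda>n. - x n)"
  by simp

instantiation ell2 :: real_normed_vector
begin

lift_definition zero_ell2 :: ell2 is "\<lambda>_. 0" by simp

lift_definition plus_ell2 :: "ell2 \<Rightarrow> ell2 \<Rightarrow> ell2" is "\<lambda>x y n. x n + y n"
  by (rule square_summable_add)

lift_definition uminus_ell2 :: "ell2 \<Rightarrow> ell2" is "\<lambda>x n. - x n"
  by simp

lift_definition minus_ell2 :: "ell2 \<Rightarrow> ell2 \<Rightarrow> ell2" is "\<lambda>x y n. x n - y n"
  using square_summable_add[OF _ square_summable_uminus] by simp

lift_definition scaleR_ell2 :: "real \<Rightarrow> ell2 \<Rightarrow> ell2" is "\<lambda>r x n. r *\<^sub>R x n"
  by (rule square_summable_dominated[where K="\<bar>r\<bar>" for r]) auto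

lift_definition norm_ell2 :: "ell2 \<Rightarrow> real" is "\<lambda>x. sqrt (\<Sum>\<^sub>\<infinity>n. (cmod (x n))\<^sup>2)" .

definition dist_ell2 :: "ell2 \<Rightarrow> ell2 \<Rightarrow> real" where "dist_ell2 x y = norm (x - y)"

definition sgn_ell2 :: "ell2 \<Rightarrow> ell2" where "sgn_ell2 x = scaleR (inverse (norm x)) x"

definition uniformity_ell2 :: "(ell2 \<times> ell2) filter" where
  "uniformity_ell2 = (INF e\<in>{0<..}. principal {(x, y). dist x y < e})"

definition open_ell2 :: "ell2 set \<Rightarrow> bool" where
  "open_ell2 U \<longleftrightarrow> (\<forall>x\<in>U. \<forall>\<^sub>F (x', y) in uniformity. x' = x \<longrightarrow> y \<in> U)"

instance
proof
  fix x y z :: ell2 and r s :: real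
  show "x + y + z = x + (y + z)" by transfer (simp add: add.assoc)
  show "x + y = y + x" by transfer (simp add: add.commute)
  show "0 + x = x" by transfer simp
  show "- x + x = 0" by transfer simp
  show "x - y = x + - y" by transfer simp
  show "r *\<^sub>R (x + y) = r *\<^sub>R x + r *\<^sub>R y" by transfer (simp add: algebra_simps)
  show "(r + s) *\<^sub>R x = r *\<^sub>R x + s *\<^sub>R x" by transfer (simp add: algebra_simps)
  show "r *\<^sub>R s *\<^sub>R x = (r * s) *\<^sub>R x" by transfer simp
  show "1 *\<^sub>R x = x" by transfer simp
  show "dist x y = norm (x - y)" by (rule dist_ell2_def)
  show "sgn x = scaleR (inverse (norm x)) x" by (rule sgn_ell2_def)
  show "uniformity = (INF e\<in>{0<..}. principal {(x :: ell2, y). dist x y < e})"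
    by (rule uniformity_ell2_def)
  show "open U \<longleftrightarrow> (\<forall>x\<in>U. \<forall>\<^sub>F (x', y) in uniformity. x' = x \<longrightarrow> y \<in> U)" for U :: "ell2 set"
    by (rule open_ell2_def)
  show "norm x = 0 \<longleftrightarrow> x = 0"
  proof
    assume "norm x = 0"
    then show "x = 0"
    proof transfer
      fix x :: "int \<Rightarrow> complex"
      assume s: "square_summable x" and 0: "sqrt (\<Sum>\<^sub>\<infinity>n. (cmod (x n))\<^sup>2) = 0"
      have "(cmod (x n))\<^sup>2 = 0" for n
        by (rule nonneg_infsum_le_0D[OF _ s]) (use 0 in auto)
      then show "x = (\<lambda>_. 0)" by auto
    qed
  qed (transfer, simp)
  show "norm (x + y) \<le> norm x + norm y"
    by transfer (rule square_summableI(2)[OF L2_set_add_le])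
  show "norm (r *\<^sub>R x) = \<bar>r\<bar> * norm x"
    by transfer (simp add: power_mult_distrib infsum_cmult_right' real_sqrt_mult)
qed

end

section \<open>Shifts, multiplication operators and limit operators\<close>

text \<open>
  Operators are elements of the library type of bounded real-linear maps. All operators defined
  below are complex-linear, and so are their strong limits.
\<close>

lemma square_summable_shift: "square_summable x \<Longrightarrow> square_summable (\<lambda>n. x (n - k))"
  by (subst summable_on_reindex_bij_betw[of "\<lambda>n. n - k" UNIV UNIV "\<lambda>n. (cmod (x n))\<^sup>2"])
     (auto intro!: bij_betwI[of _ _ _ "\<lambda>n. n + k"])

lemma infsum_shift: "(\<Sum>\<^sub>\<infinity>n. (cmod (x (n - k)))\<^sup>2) = (\<Sum>\<^sub>\<infinity>n. (cmod (x n))\<^sup>2)" for k :: int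
  by (subst infsum_reindex_bij_betw[of "\<lambda>n. n - k" UNIV UNIV "\<lambda>n. (cmod (x n))\<^sup>2"])
     (auto intro!: bij_betwI[of _ _ _ "\<lambda>n. n + k"])

lift_definition shift_fun :: "int \<Rightarrow> ell2 \<Rightarrow> ell2" is "\<lambda>k x n. x (n - k)"
  by (rule square_summable_shift)

lemma norm_shift_fun: "norm (shift_fun k x) = norm x"
  by transfer (simp add: infsum_shift)

text \<open>The integer power \<open>S\<^sup>k\<close> of the bilateral shift \<open>(S x)\<^sub>n = x\<^bsub>n-1\<^esub>\<close>.\<close>

lift_definition shift :: "int \<Rightarrow> ell2 \<Rightarrow>\<^sub>L ell2" is shift_fun
proof (rule bounded_linear_intro[where K=1])
  fix k :: int and x y :: ell2 and r :: real
  show "shift_fun k (x + y) = shift_fun k x + shift_fun k y" by transfer simp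
  show "shift_fun k (r *\<^sub>R x) = r *\<^sub>R shift_fun k x" by transfer simp
  show "norm (shift_fun k x) \<le> norm x * 1" by (simp add: norm_shift_fun)
qed

lemma coord_shift [simp]: "coord (shift k x) n = coord x (n - k)"
  by (simp add: shift.rep_eq shift_fun.rep_eq)

lemma shift_0: "shift 0 = id_blinfun"
  by (rule blinfun_eqI) (simp add: coord_inject[symmetric] fun_eq_iff)

lemma shift_add: "shift (j + k) = shift j o\<^sub>L shift k"
  by (rule blinfun_eqI) (simp add: coord_inject[symmetric] fun_eq_iff diff_diff_eq)

text \<open>
  The operator \<open>M\<^sub>b\<close> is only meaningful for bounded \<open>b\<close>; the constant sequence \<open>a\<close> gives the
  scalar multiple \<open>a I\<close> of the identity.
\<close>

definition mult_op :: "(int \<Rightarrow> complex) \<Rightarrow> ell2 \<Rightarrow>\<^sub>L ell2" where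
  "mult_op b = Blinfun (\<lambda>x. Abs_ell2 (\<lambda>n. b n * coord x n))"

lemma coord_mult_op:
  assumes "bounded (range b)"
  shows "coord (mult_op b x) n = b n * coord x n"
proof -
  from assms obtain K where K: "\<And>n. cmod (b n) \<le> K" "0 < K"
    by (auto simp: bounded_pos)
  have le: "cmod (b n * z) \<le> K * cmod z" for n z
    using K(1)[of n] by (simp add: norm_mult mult_right_mono)
  have ssx: "square_summable (coord x)" for x
    using coord by simp
  have ss: "square_summable (\<lambda>n. b n * coord x n)" for x
    by (rule square_summable_dominated[OF ssx le]) (use K in simp)
  have co: "coord (Abs_ell2 (\<lambda>n. b n * coord x n)) = (\<lambda>n. b n * coord x n)" for x
    using ss by (simp add: Abs_ell2_inverse)
  have "bounded_linear (\<lambda>x. Abs_ell2 (\<lambda>n. b n * coord x n))"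
  proof (rule bounded_linear_intro[where K=K])
    fix x y :: ell2 and r :: real
    show "Abs_ell2 (\<lambda>n. b n * coord (x + y) n)
        = Abs_ell2 (\<lambda>n. b n * coord x n) + Abs_ell2 (\<lambda>n. b n * coord y n)"
      by (simp only: coord_inject[symmetric] co plus_ell2.rep_eq[of "Abs_ell2 _"])
         (simp add: plus_ell2.rep_eq distrib_left)
    show "Abs_ell2 (\<lambda>n. b n * coord (r *\<^sub>R x) n) = r *\<^sub>R Abs_ell2 (\<lambda>n. b n * coord x n)"
      by (simp only: coord_inject[symmetric] co scaleR_ell2.rep_eq[of _ "Abs_ell2 _"])
         (simp add: scaleR_ell2.rep_eq)
    show "norm (Abs_ell2 (\<lambda>n. b n * coord x n)) \<le> norm x * K"
      unfolding norm_ell2.rep_eq co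
      by (subst mult.commute, rule square_summableI(2), rule L2_set_bounded_mult_le)
         (use ssx le K in auto)
  qed
  then show ?thesis
    by (simp add: mult_op_def bounded_linear_Blinfun_apply co)
qed

definition band_op :: "nat \<Rightarrow> int \<Rightarrow> (int \<Rightarrow> complex) \<Rightarrow> (int \<Rightarrow> complex) \<Rightarrow> ell2 \<Rightarrow>\<^sub>L ell2" where
  "band_op w0 j a b = (mult_op b o\<^sub>L shift j)
     + (\<Sum>i\<in>{- int w0..int w0} - {j}. mult_op (\<lambda>_. a i) o\<^sub>L shift i)"

definition limit_ops :: "(ell2 \<Rightarrow>\<^sub>L ell2) \<Rightarrow> (ell2 \<Rightarrow>\<^sub>L ell2) set" where
  "limit_ops A = {B :: ell2 \<Rightarrow>\<^sub>L ell2. \<exists>h :: nat \<Rightarrow> int.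
     filterlim (\<lambda>n. \<bar>h n\<bar>) at_top sequentially \<and>
     (\<forall>x. (\<lambda>n. (shift (- h n) o\<^sub>L A o\<^sub>L shift (h n)) x) \<longlonglongrightarrow> B x)}"

section \<open>Words\<close>

definition subword :: "(int \<Rightarrow> complex) \<Rightarrow> int \<Rightarrow> nat \<Rightarrow> complex list" where
  "subword b k n = map (\<lambda>i. b (k + int i)) [0..<n]"

definition sup_norm :: "complex list \<Rightarrow> real" where
  "sup_norm u = Max (insert 0 (cmod ` set u))"

text \<open>Meaningful for words of equal length only.\<close>

definition sup_dist :: "complex list \<Rightarrow> complex list \<Rightarrow> real" where
  "sup_dist u v = sup_norm (map2 (-) u v)"

definition pos :: "complex list \<Rightarrow> (int \<Rightarrow> complex) \<Rightarrow> int set" where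
  "pos w b = {k. subword b k (length w) = w}"

definition pos_eps :: "real \<Rightarrow> complex list \<Rightarrow> (int \<Rightarrow> complex) \<Rightarrow> int set" where
  "pos_eps \<epsilon> w b = {k. sup_dist (subword b k (length w)) w < \<epsilon>}"

definition subwords :: "(int \<Rightarrow> complex) \<Rightarrow> complex list set" where
  "subwords b = {w. pos w b \<noteq> {}}"

definition subwords_of_length :: "nat \<Rightarrow> (int \<Rightarrow> complex) \<Rightarrow> complex list set" where
  "subwords_of_length n b = {w \<in> subwords b. length w = n}"

lemma sup_norm_le_iff: "sup_norm u \<le> C \<longleftrightarrow> 0 \<le> C \<and> (\<forall>i<length u. cmod (u ! i) \<le> C)"
  unfolding sup_norm_def by (subst Max_le_iff) (auto simp: all_set_conv_all_nth)

lemma sup_norm_nonneg: "0 \<le> sup_norm u"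
  unfolding sup_norm_def by (rule Max_ge) auto

lemma sup_dist_le_iff:
  assumes "length u = n" "length v = n"
  shows "sup_dist u v \<le> C \<longleftrightarrow> 0 \<le> C \<and> (\<forall>i<n. cmod (u ! i - v ! i) \<le> C)"
  unfolding sup_dist_def sup_norm_le_iff using assms by simp

lemma Metric_space_words: "Metric_space {u. length u = n} sup_dist"
proof
  fix u v :: "complex list"
  show "0 \<le> sup_dist u v"
    unfolding sup_dist_def by (rule sup_norm_nonneg)
  have "map cmod (map2 (-) u v) = map cmod (map2 (-) v u)"
    by (rule nth_equalityI) (auto simp: norm_minus_commute)
  then have "cmod ` set (map2 (-) u v) = cmod ` set (map2 (-) v u)"
    by (metis list.set_map)
  then show "sup_dist u v = sup_dist v u"
    by (simp only: sup_dist_def sup_norm_def)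
next
  fix u v :: "complex list"
  assume uv: "u \<in> {u. length u = n}" "v \<in> {u. length u = n}"
  have "sup_dist u v = 0 \<longleftrightarrow> sup_dist u v \<le> 0"
    using sup_norm_nonneg[of "map2 (-) u v"] by (auto simp: sup_dist_def)
  also have "\<dots> \<longleftrightarrow> u = v"
    using uv by (subst sup_dist_le_iff[of _ n]) (auto simp: list_eq_iff_nth_eq)
  finally show "sup_dist u v = 0 \<longleftrightarrow> u = v" .
next
  fix u v w :: "complex list"
  assume uvw: "u \<in> {u. length u = n}" "v \<in> {u. length u = n}" "w \<in> {u. length u = n}"
  have le: "cmod (u ! i - v ! i) \<le> sup_dist u v" "cmod (v ! i - w ! i) \<le> sup_dist v w"
    if "i < n" for i
    using that uvw sup_dist_le_iff[of u n v "sup_dist u v"] sup_dist_le_iff[of v n w "sup_dist v w"]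
    by auto
  have "cmod (u ! i - w ! i) \<le> sup_dist u v + sup_dist v w" if "i < n" for i
    using norm_diff_triangle_le[OF le[OF that]] .
  then show "sup_dist u w \<le> sup_dist u v + sup_dist v w"
    using uvw by (subst sup_dist_le_iff[of _ n]) (auto simp: sup_dist_def sup_norm_nonneg)
qed

text \<open>The closure of a set of words of length \<open>n\<close> in the space \<open>\<complex>\<^sup>n\<close> of all such lists.\<close>

definition clos_words :: "nat \<Rightarrow> complex list set \<Rightarrow> complex list set" where
  "clos_words n V = Metric_space.mtopology {u. length u = n} sup_dist closure_of V"

text \<open>
  The infimum is taken in the extended reals, where the empty infimum is \<open>\<infinity>\<close>; a one-letter
  alphabet is therefore discrete.
\<close>

definition discrete_alphabet :: "complex set \<Rightarrow> bool" where
  "discrete_alphabet \<Sigma> \<longleftrightarrow>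
     (INF (s, t)\<in>{(s, t). s \<in> \<Sigma> \<and> t \<in> \<Sigma> \<and> s \<noteq> t}. ereal (cmod (s - t))) > 0"

end

theory Submission
  imports Defs
begin

text \<open>
  Conjugating \<open>A\<^sub>c\<close> with \<open>S\<^sup>h\<close> translates its varying diagonal, and two band operators that share
  their constant diagonals differ only by a multiplication operator times \<open>S\<^sup>j\<close>. Multiplication
  operators with uniformly bounded symbols tend strongly to \<open>0\<close> exactly when the symbols tend to
  \<open>0\<close> pointwise: testing on unit vectors gives one direction, and for the other the \<open>\<ell>\<^sup>2\<close> mass of a
  vector outside a large finite set is negligible. Hence \<open>A\<^sub>b\<close> is a limit operator of \<open>A\<^sub>c\<close> if and
  only if some translates \<open>c(\<cdot> + h\<^sub>m)\<close> with \<open>|h\<^sub>m| \<rightarrow> \<infinity>\<close> converge pointwise to \<open>b\<close>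
  (\<open>band_op_in_limit_ops_iff\<close>).

  Pointwise convergence is uniform on finite windows, so translates of this kind exist if and only
  if every finite window of \<open>b\<close> is approximated arbitrarily well at infinitely many places of \<open>c\<close>
  (\<open>translates_converge_iff_recurrent_subwords\<close>): infinitely many places are needed to let \<open>h\<^sub>m\<close>
  escape to infinity, and a diagonal choice of windows and tolerances produces the sequence.

  A word that is approximated at infinitely many places but attained at only finitely many is
  a limit of different subwords. Conversely, a limit point of different subwords is approached by
  infinitely many of them, and these occupy different places. Over a discrete alphabet, two
  different words of the same length keep a fixed distance, which excludes limit points.
\<close>

section \<open>Strong convergence of multiplication operators\<close>

lemma square_summable_coord: "square_summable (coord x)"
  using coord[of x] by simp

lemma cmod_coord_le_norm: "cmod (coord x n) \<le> norm x"
proof -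
  have "L2_set (\<lambda>k. cmod (coord x k)) {n} \<le> norm x"
    unfolding norm_ell2.rep_eq by (rule square_summable_L2_set_le[OF square_summable_coord]) simp
  then show ?thesis
    by (simp add: L2_set_def)
qed

lemma tendsto_coord:
  assumes "(f \<longlongrightarrow> x) F"
  shows "((\<lambda>m. coord (f m) n) \<longlongrightarrow> coord x n) F"
proof -
  have "((\<lambda>m. norm (f m - x)) \<longlongrightarrow> 0) F"
    using assms by (simp add: LIM_zero tendsto_norm_zero)
  moreover have "cmod (coord (f m) n - coord x n) \<le> norm (f m - x)" for m
    using cmod_coord_le_norm[of "f m - x" n] by (simp add: minus_ell2.rep_eq)
  ultimately have "((\<lambda>m. coord (f m) n - coord x n) \<longlongrightarrow> 0) F"
    by (rule Lim_null_comparison[OF always_eventually[OF allI], rotated])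
  then show ?thesis
    by (rule LIM_zero_cancel)
qed

lemma ex_unit_vector: "\<exists>e. coord e = (\<lambda>n. if n = k then 1 else 0)"
proof -
  have "square_summable (\<lambda>n. if n = k then 1 else 0)"
    by (rule finite_nonzero_values_imp_summable_on) auto
  then have "coord (Abs_ell2 (\<lambda>n. if n = k then 1 else 0)) = (\<lambda>n. if n = k then 1 else 0)"
    by (intro Abs_ell2_inverse) simp
  then show ?thesis ..
qed

text \<open>
  This is dominated convergence. Outside a finite set carrying nearly all of the mass of \<open>x\<close> only
  the bound \<open>D\<close> is available; on the finite set pointwise convergence is uniform.
\<close>

lemma mult_op_tendsto_zero:
  fixes d :: "nat \<Rightarrow> int \<Rightarrow> complex"
  assumes bound: "\<And>m n. cmod (d m n) \<le> D"
    and lim: "\<And>n. (\<lambda>m. d m n) \<longlonglongrightarrow> 0"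
  shows "(\<lambda>m. mult_op (d m) x) \<longlonglongrightarrow> 0"
proof -
  define y where "y n = (cmod (coord x n))\<^sup>2" for n
  have y: "y summable_on UNIV" and y0: "0 \<le> y n" for n
    using square_summable_coord[of x] by (simp_all add: y_def[abs_def])
  define q where "q m n = (cmod (d m n))\<^sup>2 * y n" for m n
  have "bounded (range (d m))" for m
    using bound by (auto simp: bounded_iff)
  then have q_eq: "(cmod (coord (mult_op (d m) x) n))\<^sup>2 = q m n" for m n
    by (simp add: coord_mult_op q_def y_def norm_mult power_mult_distrib)
  have q: "q m summable_on UNIV" for m
    using square_summable_coord[of "mult_op (d m) x"] by (simp add: q_eq)
  have q0: "0 \<le> q m n" for m n
    by (simp add: q_def y0)
  have qle: "q m n \<le> D\<^sup>2 * y n" for m n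
    unfolding q_def by (intro mult_right_mono power_mono bound norm_ge_zero y0)
  have "(\<lambda>m. \<Sum>\<^sub>\<infinity>n. q m n) \<longlonglongrightarrow> 0"
  proof (rule tendstoI)
    fix e :: real
    assume e: "0 < e"
    define e' where "e' = e / (2 * (D\<^sup>2 + 1))"
    have D1: "0 < D\<^sup>2 + 1"
      by (rule add_nonneg_pos) auto
    then have e': "0 < e'"
      using e by (simp add: e'_def)
    have "D\<^sup>2 * e' \<le> (D\<^sup>2 + 1) * e'"
      using e' by (intro mult_right_mono) auto
    also have "\<dots> = e / 2"
      using D1 by (simp add: e'_def field_simps)
    finally have De: "D\<^sup>2 * e' \<le> e / 2" .
    have "(sum y \<longlongrightarrow> infsum y UNIV) (finite_subsets_at_top UNIV)"
      using y by (rule infsum_tendsto)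
    then have "\<forall>\<^sub>F F in finite_subsets_at_top UNIV. dist (sum y F) (infsum y UNIV) < e'"
      using e' by (rule tendstoD)
    then obtain F where F: "finite F" "dist (sum y F) (infsum y UNIV) < e'"
      by (auto simp: eventually_finite_subsets_at_top)
    have tail: "infsum (q m) UNIV \<le> sum (q m) F + e / 2" for m
    proof (rule infsum_le_finite_sums[OF q])
      fix G :: "int set"
      assume G: "finite G"
      have "sum (q m) G \<le> sum (q m) (F \<union> G)"
        by (rule sum_mono2) (use F G q0 in auto)
      also have "\<dots> = sum (q m) F + sum (q m) (G - F)"
        using F G by (subst sum.union_disjoint[symmetric]) auto
      also have "sum (q m) (G - F) \<le> D\<^sup>2 * sum y (G - F)"
        unfolding sum_distrib_left by (rule sum_mono[OF qle])
      also have "\<dots> \<le> D\<^sup>2 * e'"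
      proof (rule mult_left_mono)
        have "sum y F + sum y (G - F) = sum y (F \<union> G)"
          using F G by (subst sum.union_disjoint[symmetric]) auto
        also have "\<dots> \<le> infsum y UNIV"
          by (rule finite_sum_le_infsum[OF y]) (use F G y0 in auto)
        finally show "sum y (G - F) \<le> e'"
          using F(2) by (simp add: dist_real_def)
      qed simp
      also note De
      finally show "sum (q m) G \<le> sum (q m) F + e / 2"
        by simp
    qed
    have "(\<lambda>m. sum (q m) F) \<longlonglongrightarrow> (\<Sum>n\<in>F. 0\<^sup>2 * y n)"
      unfolding q_def by (intro tendsto_intros tendsto_norm_zero lim)
    then have "(\<lambda>m. sum (q m) F) \<longlonglongrightarrow> 0"
      by simp
    then have "\<forall>\<^sub>F m in sequentially. sum (q m) F < e / 2"
      by (rule order_tendstoD) (use e in simp)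
    then show "\<forall>\<^sub>F m in sequentially. dist (infsum (q m) UNIV) 0 < e"
    proof eventually_elim
      case (elim m)
      then show ?case
        using tail[of m] infsum_nonneg[of UNIV "q m"] q0 by simp
    qed
  qed
  then have "(\<lambda>m. norm (mult_op (d m) x)) \<longlonglongrightarrow> 0"
    using tendsto_real_sqrt[of "\<lambda>m. infsum (q m) UNIV" 0] by (simp add: norm_ell2.rep_eq q_eq)
  then show ?thesis
    by (rule tendsto_norm_zero_cancel)
qed

section \<open>Limit operators as pointwise limits of translates\<close>

lemma coord_sum: "coord (sum f I) n = (\<Sum>i\<in>I. coord (f i) n)"
  by (induction I rule: infinite_finite_induct) (auto simp: zero_ell2.rep_eq plus_ell2.rep_eq)

lemma coord_band_op:
  assumes "bounded (range b)"
  shows "coord (band_op w0 j a b x) n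
    = b n * coord x (n - j) + (\<Sum>i\<in>{- int w0..int w0} - {j}. a i * coord x (n - i))"
  using assms
  by (simp add: band_op_def blinfun.add_left blinfun.sum_left plus_ell2.rep_eq coord_sum
      coord_mult_op)

lemma bounded_range_translate:
  assumes "bounded (range c)"
  shows "bounded (range (\<lambda>n :: int. c (n + h)))"
  by (rule bounded_subset[OF assms]) auto

lemma conjugate_shift_band_op:
  assumes "bounded (range c)"
  shows "shift (- h) o\<^sub>L band_op w0 j a c o\<^sub>L shift h = band_op w0 j a (\<lambda>n. c (n + h))"
proof (rule blinfun_eqI)
  fix x
  show "(shift (- h) o\<^sub>L band_op w0 j a c o\<^sub>L shift h) x = band_op w0 j a (\<lambda>n. c (n + h)) x"
    using assms bounded_range_translate[OF assms, of h]
    by (simp add: coord_inject[symmetric] fun_eq_iff coord_band_op algebra_simps)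
qed

lemma band_op_diff:
  assumes "bounded (range b)" "bounded (range c)"
  shows "band_op w0 j a c x - band_op w0 j a b x = mult_op (\<lambda>n. c n - b n) (shift j x)"
  using assms
  by (simp add: coord_inject[symmetric] fun_eq_iff coord_band_op coord_mult_op minus_ell2.rep_eq
      bounded_minus_comp algebra_simps)

text \<open>
  The band operators detect pointwise convergence of the diagonals because the coordinate \<open>n\<close> of
  the image of the unit vector at \<open>n - j\<close> sees the entry at \<open>n\<close> of the varying diagonal.
\<close>

lemma band_op_tendsto_iff:
  fixes c :: "nat \<Rightarrow> int \<Rightarrow> complex"
  assumes b: "\<And>n. cmod (b n) \<le> K" and c: "\<And>m n. cmod (c m n) \<le> K"
  shows "(\<forall>x. (\<lambda>m. band_op w0 j a (c m) x) \<longlonglongrightarrow> band_op w0 j a b x)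
    \<longleftrightarrow> (\<forall>n. (\<lambda>m. c m n) \<longlonglongrightarrow> b n)" (is "?L \<longleftrightarrow> ?R")
proof -
  have bdd: "bounded (range b)" "bounded (range (c m))" for m
    using b c by (auto simp: bounded_iff)
  have diff: "band_op w0 j a (c m) x - band_op w0 j a b x
      = mult_op (\<lambda>n. c m n - b n) (shift j x)" for m x
    by (rule band_op_diff[OF bdd])
  show ?thesis
  proof
    assume L: ?L
    show ?R
    proof
      fix n
      obtain e where e: "coord e = (\<lambda>k. if k = n - j then 1 else 0)"
        using ex_unit_vector by blast
      have "(\<lambda>m. coord (band_op w0 j a (c m) e - band_op w0 j a b e) n) \<longlonglongrightarrow> coord 0 n"
        by (rule tendsto_coord, rule LIM_zero) (use L in blast)
      then have "(\<lambda>m. c m n - b n) \<longlonglongrightarrow> 0"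
        using bounded_minus_comp[OF bdd(2,1)]
        by (simp add: diff coord_mult_op e zero_ell2.rep_eq)
      then show "(\<lambda>m. c m n) \<longlonglongrightarrow> b n"
        by (rule LIM_zero_cancel)
    qed
  next
    assume R: ?R
    show ?L
    proof
      fix x
      have "(\<lambda>m. mult_op (\<lambda>n. c m n - b n) (shift j x)) \<longlonglongrightarrow> 0"
      proof (rule mult_op_tendsto_zero)
        show "cmod (c m n - b n) \<le> K + K" for m n
          by (rule order_trans[OF norm_triangle_ineq4 add_mono[OF c b]])
        show "(\<lambda>m. c m n - b n) \<longlonglongrightarrow> 0" for n
          by (rule LIM_zero) (use R in blast)
      qed
      then have "(\<lambda>m. band_op w0 j a (c m) x - band_op w0 j a b x) \<longlonglongrightarrow> 0"
        by (simp add: diff)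
      then show "(\<lambda>m. band_op w0 j a (c m) x) \<longlonglongrightarrow> band_op w0 j a b x"
        by (rule LIM_zero_cancel)
    qed
  qed
qed

lemma band_op_in_limit_ops_iff:
  assumes "bounded (range b)" "bounded (range c)"
  shows "band_op w0 j a b \<in> limit_ops (band_op w0 j a c)
    \<longleftrightarrow> (\<exists>h. filterlim (\<lambda>m. \<bar>h m\<bar>) at_top sequentially \<and> (\<forall>n. (\<lambda>m. c (n + h m)) \<longlonglongrightarrow> b n))"
proof -
  have "bounded (range b \<union> range c)"
    using assms by simp
  then obtain K where "\<forall>x\<in>range b \<union> range c. cmod x \<le> K"
    unfolding bounded_iff by blast
  then have K: "cmod (b n) \<le> K" "cmod (c n) \<le> K" for n
    by auto
  have "(\<forall>x. (\<lambda>m. (shift (- h m) o\<^sub>L band_op w0 j a c o\<^sub>L shift (h m)) x) \<longlonglongrightarrow> band_op w0 j a b x)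
      \<longleftrightarrow> (\<forall>n. (\<lambda>m. c (n + h m)) \<longlonglongrightarrow> b n)" for h
    unfolding conjugate_shift_band_op[OF assms(2)]
    by (rule band_op_tendsto_iff[of b K "\<lambda>m n. c (n + h m)" w0 j a, OF K(1) K(2)])
  then show ?thesis
    by (simp only: limit_ops_def mem_Collect_eq)
qed

section \<open>Approximate occurrences of words\<close>

lemma sup_dist_less_iff:
  assumes "length u = n" "length v = n" "0 < \<epsilon>"
  shows "sup_dist u v < \<epsilon> \<longleftrightarrow> (\<forall>i<n. cmod (u ! i - v ! i) < \<epsilon>)"
  unfolding sup_dist_def sup_norm_def using assms
  by (subst Max_less_iff) (auto simp: all_set_conv_all_nth)

lemma length_subword [simp]: "length (subword b k n) = n"
  by (simp add: subword_def)

lemma nth_subword [simp]: "i < n \<Longrightarrow> subword b k n ! i = b (k + int i)"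
  by (simp add: subword_def)

lemma subword_in_subwords [simp]: "subword b k n \<in> subwords b"
  by (auto simp: subwords_def pos_def)

lemma in_subwordsE:
  assumes "w \<in> subwords b"
  obtains k where "w = subword b k (length w)"
proof -
  obtain k where "subword b k (length w) = w"
    using assms by (auto simp: subwords_def pos_def)
  from that[OF this[symmetric]] show ?thesis .
qed

lemma pos_eps_iff:
  "0 < \<epsilon> \<Longrightarrow> k \<in> pos_eps \<epsilon> w c \<longleftrightarrow> (\<forall>i<length w. cmod (c (k + int i) - w ! i) < \<epsilon>)"
  unfolding pos_eps_def by (simp add: sup_dist_less_iff)

text \<open>
  If only finitely many places were available, then \<open>k + h\<^sub>m\<close> would be bounded along the sequence.
  Conversely, \<open>h\<^sub>m\<close> is chosen so that the translate of \<open>c\<close> by \<open>h\<^sub>m\<close> is \<open>1/(m+1)\<close>-close to \<open>b\<close> on the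
  window \<open>{-m..m}\<close>; since only finitely many places \<open>k\<close> violate \<open>|k + m| \<ge> m\<close>, the choice can be
  made with \<open>|h\<^sub>m| \<ge> m\<close>.
\<close>

lemma translates_converge_iff_recurrent_subwords:
  fixes b c :: "int \<Rightarrow> complex"
  shows "(\<exists>h. filterlim (\<lambda>m. \<bar>h m\<bar>) at_top sequentially \<and> (\<forall>n. (\<lambda>m. c (n + h m)) \<longlonglongrightarrow> b n))
    \<longleftrightarrow> (\<forall>w\<in>subwords b. \<forall>\<epsilon>>0. infinite (pos_eps \<epsilon> w c))" (is "?L \<longleftrightarrow> ?R")
proof
  assume ?L
  then obtain h where h: "filterlim (\<lambda>m. \<bar>h m\<bar>) at_top sequentially"
    and lim: "\<And>n. (\<lambda>m. c (n + h m)) \<longlonglongrightarrow> b n"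
    by blast
  show ?R
  proof (intro ballI allI impI notI)
    fix w and \<epsilon> :: real
    assume "w \<in> subwords b" and \<epsilon>: "0 < \<epsilon>" and fin: "finite (pos_eps \<epsilon> w c)"
    then obtain k where k: "w = subword b k (length w)"
      by (blast elim: in_subwordsE)
    have letter: "w ! i = b (k + int i)" if "i < length w" for i
      using that by (subst k) simp
    define B where "B = Max (abs ` pos_eps \<epsilon> w c)"
    have B: "\<bar>p\<bar> \<le> B" if "p \<in> pos_eps \<epsilon> w c" for p
      using fin that by (simp add: B_def)
    have "\<forall>\<^sub>F m in sequentially. \<forall>i\<in>{..<length w}. dist (c (k + int i + h m)) (b (k + int i)) < \<epsilon>"
      by (intro eventually_ball_finite ballI finite_lessThan tendstoD[OF lim \<epsilon>])
    moreover have "\<forall>\<^sub>F m in sequentially. B + \<bar>k\<bar> + 1 \<le> \<bar>h m\<bar>"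
      using h by (simp add: filterlim_at_top)
    ultimately have "\<forall>\<^sub>F m in sequentially. False"
    proof eventually_elim
      case (elim m)
      then have "k + h m \<in> pos_eps \<epsilon> w c"
        using \<epsilon> by (simp add: pos_eps_iff letter dist_norm add_ac)
      from B[OF this] elim show False
        by linarith
    qed
    then show False
      by simp
  qed
next
  assume R: ?R
  have "\<exists>g. int m \<le> \<bar>g\<bar> \<and> (\<forall>n. \<bar>n\<bar> \<le> int m \<longrightarrow> cmod (c (n + g) - b n) < inverse (real (Suc m)))" for m
  proof -
    define w where "w = subword b (- int m) (2 * m + 1)"
    define \<epsilon> where "\<epsilon> = inverse (real (Suc m))"
    have \<epsilon>: "0 < \<epsilon>"
      by (simp add: \<epsilon>_def)
    then have "infinite (pos_eps \<epsilon> w c)"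
      using R by (simp add: w_def)
    moreover have "finite {- 2 * int m..0}"
      by simp
    ultimately have "infinite (pos_eps \<epsilon> w c - {- 2 * int m..0})"
      by (rule Diff_infinite_finite[rotated])
    then have "pos_eps \<epsilon> w c - {- 2 * int m..0} \<noteq> {}"
      by (metis finite.emptyI)
    then obtain k where k: "k \<in> pos_eps \<epsilon> w c" "k \<notin> {- 2 * int m..0}"
      by blast
    have "cmod (c (n + (k + int m)) - b n) < \<epsilon>" if n: "\<bar>n\<bar> \<le> int m" for n
    proof -
      define i where "i = nat (n + int m)"
      have i: "i < 2 * m + 1" "int i = n + int m"
        using n by (auto simp: i_def)
      have "cmod (c (k + int i) - w ! i) < \<epsilon>"
        using k(1) \<epsilon> i(1) by (simp add: pos_eps_iff w_def)
      then show ?thesis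
        using i(1) by (simp add: w_def i(2) algebra_simps)
    qed
    moreover have "int m \<le> \<bar>k + int m\<bar>"
      using k(2) by auto
    ultimately show ?thesis
      unfolding \<epsilon>_def by blast
  qed
  then obtain h where h: "\<And>m. int m \<le> \<bar>h m\<bar>"
    and close: "\<And>m n. \<bar>n\<bar> \<le> int m \<Longrightarrow> cmod (c (n + h m) - b n) < inverse (real (Suc m))"
    by metis
  have "filterlim (\<lambda>m. \<bar>h m\<bar>) at_top sequentially"
    by (rule filterlim_at_top_mono[OF filterlim_int_sequentially]) (simp add: h)
  moreover have "(\<lambda>m. c (n + h m)) \<longlonglongrightarrow> b n" for n
  proof (rule LIM_zero_cancel, rule Lim_null_comparison[OF _ LIMSEQ_inverse_real_of_nat])
    show "\<forall>\<^sub>F m in sequentially. cmod (c (n + h m) - b n) \<le> inverse (real (Suc m))"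
      using eventually_ge_at_top[of "nat \<bar>n\<bar>"]
    proof eventually_elim
      case (elim m)
      then show ?case
        by (intro close[THEN less_imp_le]) linarith
    qed
  qed
  ultimately show ?L
    by blast
qed

section \<open>Limit points of the set of subwords\<close>

lemma in_clos_words_iff:
  assumes "length w = n" "V \<subseteq> {u. length u = n}"
  shows "w \<in> clos_words n V \<longleftrightarrow> (\<forall>\<epsilon>>0. \<exists>v\<in>V. sup_dist v w < \<epsilon>)"
proof -
  interpret Metric_space "{u. length u = n}" sup_dist
    by (rule Metric_space_words)
  show ?thesis
    unfolding clos_words_def metric_closure_of using assms
    by (auto simp: in_mball commute subset_iff; metis commute)
qed

lemma in_clos_other_subwords_iff:
  "w \<in> clos_words (length w) (subwords_of_length (length w) c - {w})
    \<longleftrightarrow> (\<forall>\<epsilon>>0. pos_eps \<epsilon> w c - pos w c \<noteq> {})"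
proof -
  have words: "subwords_of_length (length w) c = range (\<lambda>k. subword c k (length w))"
    by (auto simp: subwords_of_length_def subwords_def pos_def)
  have "w \<in> clos_words (length w) (subwords_of_length (length w) c - {w}) \<longleftrightarrow>
      (\<forall>\<epsilon>>0. \<exists>v\<in>subwords_of_length (length w) c - {w}. sup_dist v w < \<epsilon>)"
    by (rule in_clos_words_iff) (auto simp: subwords_of_length_def)
  also have "\<dots> \<longleftrightarrow> (\<forall>\<epsilon>>0. pos_eps \<epsilon> w c - pos w c \<noteq> {})"
    unfolding words pos_eps_def pos_def by blast
  finally show ?thesis .
qed

text \<open>
  Suppose \<open>w\<close> is a limit point but only finitely many places are \<open>\<epsilon>\<close>-approximate. The subwords at
  those places that differ from \<open>w\<close> keep a positive distance \<open>\<delta>\<close> from \<open>w\<close>, so no place is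
  \<open>min \<epsilon> \<delta>\<close>-approximate without being exact.
\<close>

lemma recurrent_iff_infinite_or_limit_point:
  "(\<forall>\<epsilon>>0. infinite (pos_eps \<epsilon> w c)) \<longleftrightarrow> infinite (pos w c)
    \<or> w \<in> clos_words (length w) (subwords_of_length (length w) c - {w})"
proof -
  interpret Metric_space "{u. length u = length w}" sup_dist
    by (rule Metric_space_words)
  have mono: "pos w c \<subseteq> pos_eps \<epsilon> w c" if "0 < \<epsilon>" for \<epsilon>
    using that by (auto simp: pos_eps_def pos_def)
  have "infinite (pos_eps \<epsilon> w c)"
    if limit: "\<And>\<epsilon>. 0 < \<epsilon> \<Longrightarrow> pos_eps \<epsilon> w c - pos w c \<noteq> {}" and \<epsilon>: "0 < \<epsilon>" for \<epsilon>
  proof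
    assume fin: "finite (pos_eps \<epsilon> w c)"
    define dists where "dists = (\<lambda>k. sup_dist (subword c k (length w)) w) ` (pos_eps \<epsilon> w c - pos w c)"
    have dists: "finite dists" "dists \<noteq> {}"
      using fin limit[OF \<epsilon>] by (auto simp: dists_def)
    have "0 < d" if "d \<in> dists" for d
      using that by (auto simp: dists_def pos_def intro!: mdist_pos_less)
    then have "0 < Min dists"
      using dists by simp
    with \<epsilon> obtain k where k: "k \<in> pos_eps (min \<epsilon> (Min dists)) w c" "k \<notin> pos w c"
      using limit[of "min \<epsilon> (Min dists)"] by auto
    then have "sup_dist (subword c k (length w)) w \<in> dists"
      by (auto simp: dists_def pos_eps_def)
    then have "Min dists \<le> sup_dist (subword c k (length w)) w"
      using dists by simp
    with k(1) show False
      by (simp add: pos_eps_def)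
  qed
  moreover have "infinite (pos_eps \<epsilon> w c)" if "infinite (pos w c)" "0 < \<epsilon>" for \<epsilon>
    using mono[OF that(2)] that(1) by (rule infinite_super)
  moreover have "pos_eps \<epsilon> w c - pos w c \<noteq> {}"
    if "infinite (pos_eps \<epsilon> w c)" "finite (pos w c)" for \<epsilon>
  proof
    assume "pos_eps \<epsilon> w c - pos w c = {}"
    then have "pos_eps \<epsilon> w c \<subseteq> pos w c"
      by simp
    with that show False
      by (blast dest: finite_subset)
  qed
  ultimately show ?thesis
    unfolding in_clos_other_subwords_iff by meson
qed

lemma discrete_alphabet_gap:
  assumes "discrete_alphabet \<Sigma>"
  shows "\<exists>\<delta>>0. \<forall>s\<in>\<Sigma>. \<forall>t\<in>\<Sigma>. cmod (s - t) < \<delta> \<longrightarrow> s = t"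
proof -
  from assms obtain r where r: "0 < ereal r"
    "ereal r < (INF (s, t)\<in>{(s, t). s \<in> \<Sigma> \<and> t \<in> \<Sigma> \<and> s \<noteq> t}. ereal (cmod (s - t)))"
    unfolding discrete_alphabet_def by (meson ereal_dense2)
  show ?thesis
  proof (intro exI conjI ballI impI)
    show "0 < r"
      using r(1) by simp
    fix s t
    assume st: "s \<in> \<Sigma>" "t \<in> \<Sigma>" "cmod (s - t) < r"
    show "s = t"
    proof (rule ccontr)
      assume "s \<noteq> t"
      then have "(INF (s, t)\<in>{(s, t). s \<in> \<Sigma> \<and> t \<in> \<Sigma> \<and> s \<noteq> t}. ereal (cmod (s - t)))
          \<le> ereal (cmod (s - t))"
        using st by (intro INF_lower2[of "(s, t)"]) auto
      with r(2) have "ereal r < ereal (cmod (s - t))"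
        by (rule less_le_trans)
      with st(3) show False
        by simp
    qed
  qed
qed

lemma discrete_alphabet_no_limit_point:
  assumes "discrete_alphabet \<Sigma>" "range b \<subseteq> \<Sigma>" "range c \<subseteq> \<Sigma>" "w \<in> subwords b"
  shows "w \<notin> clos_words (length w) (subwords_of_length (length w) c - {w})"
proof -
  obtain \<delta> where \<delta>: "0 < \<delta>"
    and gap: "\<And>s t. s \<in> \<Sigma> \<Longrightarrow> t \<in> \<Sigma> \<Longrightarrow> cmod (s - t) < \<delta> \<Longrightarrow> s = t"
    using discrete_alphabet_gap[OF assms(1)] by blast
  obtain l where l: "w = subword b l (length w)"
    using assms(4) by (rule in_subwordsE)
  have letter: "w ! i \<in> \<Sigma>" if "i < length w" for i
    using that assms(2) by (subst l) auto
  have "k \<in> pos w c" if "k \<in> pos_eps \<delta> w c" for k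
    using that \<delta> assms(3)
    by (auto simp: pos_def pos_eps_iff list_eq_iff_nth_eq intro!: gap letter)
  with \<delta> show ?thesis
    unfolding in_clos_other_subwords_iff by blast
qed

section \<open>Limit operators and recurrent subwords\<close>

theorem lemma4p3:
  fixes \<Sigma> :: "complex set" and w0 :: nat and j :: int and a b c :: "int \<Rightarrow> complex"
  assumes "compact \<Sigma>"
    and "j \<in> {- int w0..int w0}"
    and "range b \<subseteq> \<Sigma>"
    and "range c \<subseteq> \<Sigma>"
  shows "(band_op w0 j a b \<in> limit_ops (band_op w0 j a c)
            \<longleftrightarrow> (\<forall>w\<in>subwords b. \<forall>\<epsilon>>0. infinite (pos_eps \<epsilon> w c)))
       \<and> (\<forall>w\<in>subwords b. (\<forall>\<epsilon>>0. infinite (pos_eps \<epsilon> w c))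
            \<longleftrightarrow> infinite (pos w c)
              \<or> w \<in> clos_words (length w) (subwords_of_length (length w) c - {w}))
       \<and> (discrete_alphabet \<Sigma> \<longrightarrow>
            (\<forall>w\<in>subwords b.
               w \<notin> clos_words (length w) (subwords_of_length (length w) c - {w})
             \<and> ((\<forall>\<epsilon>>0. infinite (pos_eps \<epsilon> w c)) \<longleftrightarrow> infinite (pos w c))))"
proof -
  have "bounded \<Sigma>"
    using \<open>compact \<Sigma>\<close> by (rule compact_imp_bounded)
  then have bdd: "bounded (range b)" "bounded (range c)"
    using \<open>range b \<subseteq> \<Sigma>\<close> \<open>range c \<subseteq> \<Sigma>\<close> by (auto intro: bounded_subset)
  show ?thesis
    using band_op_in_limit_ops_iff[OF bdd, of w0 j a] translates_converge_iff_recurrent_subwords[of c b]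
      recurrent_iff_infinite_or_limit_point[of _ c]
      discrete_alphabet_no_limit_point[OF _ \<open>range b \<subseteq> \<Sigma>\<close> \<open>range c \<subseteq> \<Sigma>\<close>]
    by simp
qed

end
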